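(* Let pools $1,\dots,N$, with trade functions extended by concave continuation to $(-R_i,\infty)$, and a total input $q\ge0$ be given, and consider any run of the extended transfer algorithm, in which every transfer satisfies the legitimacy requirement. Let $\mathbf{x}^{(k)}$ be the allocation after $k$ rounds (with $\mathbf{x}^{(0)}$ the allocation produced by the greedy initialization), and put $S_+^{(k)}=\{j: x_j^{(k)}>0\}$ and $S_-^{(k)}=\{j: x_j^{(k)}<0\}$. Then: (i) If $j\in S_+^{(l)}$ for some round $l\ge0$, then $j\in S_+^{(m)}$ for all rounds $m>l$ of the run. (ii) If $j\in S_-^{(l)}$ for some round $l\ge0$, then $j\in S_-^{(m)}$ for all rounds $m>l$ of the run.
   Context: Pools. For each $i=1,\dots,N$, pool $i$ has a trade function $E^i_{X,Y}:[0,\infty)\to[0,\infty)$ (input of token $X$ to output of token $Y$) and a reverse trade function $E^i_{Y,X}:[0,\infty)\to[0,\infty)$ (input of $Y$ to output of $X$). Both are $C^1$ (one-sided at $0$) with strictly positive derivative, strictly concave, vanish at $0$, and satisfy $(E^i_{X,Y})'(0)\cdot(E^i_{Y,X})'(0)=1$. The reserve of token $X$ in pool $i$ is $R_i\in(0,\infty)$, and $E^i_{Y,X}([0,\infty))=[0,R_i)$. Concave continuation. $E^i_{X,Y}$ is extended to $(-R_i,\infty)$ by $E^i_{X,Y}(x):=-(E^i_{Y,X})^{-1}(-x)$ for $-R_i<x<0$. The price function of pool $i$ is $P_i(x)=1/(E^i_{X,Y})'(x)$ for $x\in(-R_i,\infty)$. Extended transfer algorithm. Inputs: the pools, a total input $q\ge0$,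 a tolerance $\varepsilon\ge0$, a number of portions $M\ge1$. Greedy initialization: start from $\mathbf{x}^{(0)}=\mathbf{0}$; repeat $M$ times: choose $R\in\arg\min_i P_i(x_i^{(0)})$ and replace $x_R^{(0)}$ by $x_R^{(0)}+q/M$. Rounds: given the current allocation $\mathbf{x}$, choose a donor $D\in\arg\max_i P_i(x_i)$ and a receiver $R\in\arg\min_i P_i(x_i)$ (ties broken arbitrarily). If $(P_D(x_D)-P_R(x_R))/P_D(x_D)\le\varepsilon$, stop and return $\mathbf{x}$. Otherwise compute $\delta$ by the extended halving rule: initialize $\delta=x_D/2$ if $x_D>0$, and $\delta=(R_D+x_D)/2$ if $x_D\le0$, where $R_D$ is the reserve of token $X$ in pool $D$; while $P_D(x_D-\delta)<P_R(x_R+\delta)$, replace $\delta$ by $\delta/2$. Then replace $x_D$ by $x_D-\delta$ and $x_R$ by $x_R+\delta$; this completes one round. Legitimacy requirement: a transfer of $\delta>0$ from donor $D$ to receiver $R$ is legitimate if $P_D(x_D-\delta)\ge P_R(x_R+\delta)$. The halving rule only produces legitimate transfers. *)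

theory Defs
  imports "HOL-Analysis.Analysis" "HOL-Library.Extended_Nat"
begin

definition strictly_concave_on :: "real set \<Rightarrow> (real \<Rightarrow> real) \<Rightarrow> bool" where
  "strictly_concave_on S f \<longleftrightarrow> convex S \<and>
     (\<forall>x\<in>S. \<forall>y\<in>S. \<forall>t. x \<noteq> y \<and> 0 < t \<and> t < 1 \<longrightarrow>
        (1 - t) * f x + t * f y < f ((1 - t) * x + t * y))"

text \<open>The derivative relative to \<open>[0,\<infinity>)\<close>: one-sided at \<open>0\<close>, the ordinary one at every \<open>x > 0\<close>.\<close>

definition deriv_nonneg :: "(real \<Rightarrow> real) \<Rightarrow> real \<Rightarrow> real" where
  "deriv_nonneg f x = vector_derivative f (at x within {0..})"

definition trade_function :: "(real \<Rightarrow> real) \<Rightarrow> bool" where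
  "trade_function f \<longleftrightarrow>
     f ` {0..} \<subseteq> {0..} \<and>
     f differentiable_on {0..} \<and>
     continuous_on {0..} (deriv_nonneg f) \<and>
     (\<forall>x\<ge>0. deriv_nonneg f x > 0) \<and>
     strictly_concave_on {0..} f \<and>
     f 0 = 0"

text \<open>\<open>trade_XY\<close> and \<open>trade_YX\<close> are only meaningful on \<open>[0,\<infinity>)\<close>; \<open>reserve\<close> is the reserve
  of token \<open>X\<close>.\<close>

record pool =
  trade_XY :: "real \<Rightarrow> real"
  trade_YX :: "real \<Rightarrow> real"
  reserve :: real

definition valid_pool :: "pool \<Rightarrow> bool" where
  "valid_pool p \<longleftrightarrow>
     trade_function (trade_XY p) \<and>
     trade_function (trade_YX p) \<and>
     deriv_nonneg (trade_XY p) 0 * deriv_nonneg (trade_YX p) 0 = 1 \<and>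
     0 < reserve p \<and>
     trade_YX p ` {0..} = {0..<reserve p}"

text \<open>Only the values on \<open>(-reserve p, \<infinity>)\<close> are meaningful.\<close>

definition extended_trade :: "pool \<Rightarrow> real \<Rightarrow> real" where
  "extended_trade p x =
     (if 0 \<le> x then trade_XY p x else - inv_into {0..} (trade_YX p) (- x))"

definition price :: "pool \<Rightarrow> real \<Rightarrow> real" where
  "price p x = 1 / deriv (extended_trade p) x"

text \<open>The pools are \<open>pools 1, \<dots>, pools N\<close>. An allocation is a function on \<open>nat\<close> of which only
  the values on \<open>{1..N}\<close> matter.\<close>

type_synonym allocation = "nat \<Rightarrow> real"

definition is_donor :: "(nat \<Rightarrow> pool) \<Rightarrow> nat \<Rightarrow> allocation \<Rightarrow> nat \<Rightarrow> bool" where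
  "is_donor pools N x D \<longleftrightarrow> is_arg_max (\<lambda>i. price (pools i) (x i)) (\<lambda>i. i \<in> {1..N}) D"

definition is_receiver :: "(nat \<Rightarrow> pool) \<Rightarrow> nat \<Rightarrow> allocation \<Rightarrow> nat \<Rightarrow> bool" where
  "is_receiver pools N x R \<longleftrightarrow> is_arg_min (\<lambda>i. price (pools i) (x i)) (\<lambda>i. i \<in> {1..N}) R"

text \<open>\<open>greedy pools N s n x\<close>: \<open>n\<close> portions of size \<open>s\<close>, handed out greedily, may yield \<open>x\<close>.\<close>

inductive greedy :: "(nat \<Rightarrow> pool) \<Rightarrow> nat \<Rightarrow> real \<Rightarrow> nat \<Rightarrow> allocation \<Rightarrow> bool"
  for pools :: "nat \<Rightarrow> pool" and N :: nat and s :: real where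
  start: "greedy pools N s 0 (\<lambda>_. 0)"
| portion: "greedy pools N s n x \<Longrightarrow> is_receiver pools N x R \<Longrightarrow>
     greedy pools N s (Suc n) (x(R := x R + s))"

definition greedy_initialization ::
    "(nat \<Rightarrow> pool) \<Rightarrow> nat \<Rightarrow> real \<Rightarrow> nat \<Rightarrow> allocation \<Rightarrow> bool" where
  "greedy_initialization pools N q M x \<longleftrightarrow> greedy pools N (q / real M) M x"

definition stopping :: "(nat \<Rightarrow> pool) \<Rightarrow> real \<Rightarrow> allocation \<Rightarrow> nat \<Rightarrow> nat \<Rightarrow> bool" where
  "stopping pools \<epsilon> x D R \<longleftrightarrow>
     (price (pools D) (x D) - price (pools R) (x R)) / price (pools D) (x D) \<le> \<epsilon>"

definition legitimate ::
    "(nat \<Rightarrow> pool) \<Rightarrow> allocation \<Rightarrow> nat \<Rightarrow> nat \<Rightarrow> real \<Rightarrow> bool" where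
  "legitimate pools x D R \<delta> \<longleftrightarrow>
     \<delta> > 0 \<and> price (pools D) (x D - \<delta>) \<ge> price (pools R) (x R + \<delta>)"

definition initial_delta :: "(nat \<Rightarrow> pool) \<Rightarrow> allocation \<Rightarrow> nat \<Rightarrow> real" where
  "initial_delta pools x D =
     (if x D > 0 then x D / 2 else (reserve (pools D) + x D) / 2)"

text \<open>Big-step semantics of the while loop: \<open>halving pools x D R \<delta> \<delta>'\<close> says that the loop, entered
  with \<open>\<delta>\<close>, terminates with \<open>\<delta>'\<close>.\<close>

inductive halving ::
    "(nat \<Rightarrow> pool) \<Rightarrow> allocation \<Rightarrow> nat \<Rightarrow> nat \<Rightarrow> real \<Rightarrow> real \<Rightarrow> bool"
  for pools :: "nat \<Rightarrow> pool" and x :: allocation and D R :: nat where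
  exit_loop: "\<not> price (pools D) (x D - \<delta>) < price (pools R) (x R + \<delta>) \<Longrightarrow>
     halving pools x D R \<delta> \<delta>"
| halve: "price (pools D) (x D - \<delta>) < price (pools R) (x R + \<delta>) \<Longrightarrow>
     halving pools x D R (\<delta> / 2) \<delta>' \<Longrightarrow> halving pools x D R \<delta> \<delta>'"

text \<open>Since \<open>\<epsilon> \<ge> 0\<close>, the failing stopping test forces \<open>D \<noteq> R\<close>, so the
  two updates do not interfere.\<close>

definition transfer_round ::
    "(nat \<Rightarrow> pool) \<Rightarrow> nat \<Rightarrow> real \<Rightarrow> allocation \<Rightarrow> nat \<Rightarrow> nat \<Rightarrow> real \<Rightarrow> allocation \<Rightarrow> bool" where
  "transfer_round pools N \<epsilon> x D R \<delta> x' \<longleftrightarrow>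
     is_donor pools N x D \<and> is_receiver pools N x R \<and>
     \<not> stopping pools \<epsilon> x D R \<and>
     halving pools x D R (initial_delta pools x D) \<delta> \<and>
     x' = x(D := x D - \<delta>, R := x R + \<delta>)"

text \<open>A run consisting of \<open>K\<close> completed rounds, where \<open>K = \<infinity>\<close> for a run that never stops: \<open>x k\<close> is the
  allocation after \<open>k\<close> rounds, and the next round transfers \<open>\<delta> k\<close> from \<open>D k\<close> to \<open>R k\<close>.
  The sequences carry no information beyond the end of the run.\<close>

definition transfer_run ::
    "(nat \<Rightarrow> pool) \<Rightarrow> nat \<Rightarrow> real \<Rightarrow> real \<Rightarrow> nat \<Rightarrow> enat \<Rightarrow> (nat \<Rightarrow> allocation) \<Rightarrow>
     (nat \<Rightarrow> nat) \<Rightarrow> (nat \<Rightarrow> nat) \<Rightarrow> (nat \<Rightarrow> real) \<Rightarrow> bool" where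
  "transfer_run pools N q \<epsilon> M K x D R \<delta> \<longleftrightarrow>
     greedy_initialization pools N q M (x 0) \<and>
     (\<forall>k. enat k < K \<longrightarrow> transfer_round pools N \<epsilon> (x k) (D k) (R k) (\<delta> k) (x (Suc k))) \<and>
     (\<forall>k. K = enat k \<longrightarrow>
        (\<exists>D' R'. is_donor pools N (x k) D' \<and> is_receiver pools N (x k) R' \<and>
           stopping pools \<epsilon> (x k) D' R'))"

definition S_plus :: "nat \<Rightarrow> allocation \<Rightarrow> nat set" where
  "S_plus N x = {j \<in> {1..N}. x j > 0}"

definition S_minus :: "nat \<Rightarrow> allocation \<Rightarrow> nat set" where
  "S_minus N x = {j \<in> {1..N}. x j < 0}"

end

theory Submission
  imports Defs
begin

text \<open>The first claim is immediate, as a donor with \<open>x\<^sub>D > 0\<close> gives away at most half of \<open>x\<^sub>D\<close>. For the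
  second, legitimate transfers never raise the maximal price, and a pool \<open>j\<close> can only become
  negative when it is a donor with \<open>x\<^sub>j \<le> 0\<close>, that is, when the maximal price is at most \<open>P\<^sub>j(0)\<close>.
  Hence, as long as \<open>x\<^sub>j < 0\<close>, all prices are bounded by \<open>P\<^sub>j(0)\<close>; if \<open>j\<close> receives, its new price is
  smaller than the price of the donor, so less than \<open>P\<^sub>j(0)\<close>, and \<open>x\<^sub>j\<close> remains negative because
  \<open>P\<^sub>j\<close> is strictly increasing.\<close>

section \<open>Derivatives of strictly concave functions\<close>

text \<open>Strict concavity at the weight \<open>t = (y - x) / (z - x)\<close>, multiplied by
  \<open>z - x\<close>. Free of divisions, the inequality rearranges into any comparison of the
  three chord slopes.\<close>

lemma strictly_concave_on_secant:
  assumes "strictly_concave_on S f" "x \<in> S" "z \<in> S" "x < y" "y < z"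
  shows "(z - y) * f x + (y - x) * f z < (z - x) * f y"
proof -
  define t where "t = (y - x) / (z - x)"
  have "0 < t" "t < 1" using assms by (auto simp: t_def)
  then have "(1 - t) * f x + t * f z < f ((1 - t) * x + t * z)"
    using assms unfolding strictly_concave_on_def by (metis less_irrefl less_trans)
  moreover have "(1 - t) * x + t * z = x + t * (z - x)" by (simp add: algebra_simps)
  then have "(1 - t) * x + t * z = y" using assms by (simp add: t_def)
  ultimately have "(z - x) * ((1 - t) * f x + t * f z) < (z - x) * f y"
    using assms by simp
  moreover have "(z - x) * t = y - x" using assms by (simp add: t_def)
  then have "(z - x) * (1 - t) = z - y" "(z - x) * t = y - x"
    by (simp_all add: right_diff_distrib)
  then have "(z - x) * ((1 - t) * f x + t * f z) = (z - y) * f x + (y - x) * f z"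
    by (simp only: distrib_left mult.assoc [symmetric])
  ultimately show ?thesis by simp
qed

text \<open>The chord from \<open>x\<close> to an intermediate \<open>y\<close> is steeper than the
  chord to \<open>z\<close>; let \<open>y\<close> tend to \<open>x\<close> inside
  \<open>{x<..<z}\<close>. Restricting the limit to this interval lets one-sided derivatives at the
  boundary of \<open>S\<close> count as well.\<close>

lemma strictly_concave_on_left_tangent:
  assumes "strictly_concave_on S f" "x \<in> S" "z \<in> S" "x < z"
    and "(f has_real_derivative l) (at x within S)"
  shows "(f z - f x) / (z - x) \<le> l"
proof (rule tendsto_lowerbound)
  have "convex S" using assms(1) by (simp add: strictly_concave_on_def)
  then have "{x<..<z} \<subseteq> S"
    using assms(2,3) by (meson connected_contains_Ioo convex_connected)
  then have "(f has_real_derivative l) (at x within {x<..<z})"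
    using assms(5) by (rule has_field_derivative_subset [rotated])
  then show "((\<lambda>y. (f y - f x) / (y - x)) \<longlongrightarrow> l) (at x within {x<..<z})"
    by (simp add: has_field_derivative_iff)
  show "\<forall>\<^sub>F y in at x within {x<..<z}. (f z - f x) / (z - x) \<le> (f y - f x) / (y - x)"
    unfolding eventually_at_filter
  proof (intro always_eventually allI impI)
    fix y assume y: "y \<in> {x<..<z}"
    then have "(z - y) * f x + (y - x) * f z < (z - x) * f y"
      using strictly_concave_on_secant assms by auto
    then show "(f z - f x) / (z - x) \<le> (f y - f x) / (y - x)"
      using y by (simp add: divide_le_eq le_divide_eq) (simp add: field_simps)
  qed
  show "at x within {x<..<z} \<noteq> bot"
    using assms(4) by (simp add: at_within_eq_bot_iff)
qed

lemma strictly_concave_on_right_tangent: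
  assumes "strictly_concave_on S f" "x \<in> S" "z \<in> S" "x < z"
    and "(f has_real_derivative l) (at z within S)"
  shows "l \<le> (f z - f x) / (z - x)"
proof (rule tendsto_upperbound)
  have "convex S" using assms(1) by (simp add: strictly_concave_on_def)
  then have "{x<..<z} \<subseteq> S"
    using assms(2,3) by (meson connected_contains_Ioo convex_connected)
  then have "(f has_real_derivative l) (at z within {x<..<z})"
    using assms(5) by (rule has_field_derivative_subset [rotated])
  then show "((\<lambda>y. (f y - f z) / (y - z)) \<longlongrightarrow> l) (at z within {x<..<z})"
    by (simp add: has_field_derivative_iff)
  show "\<forall>\<^sub>F y in at z within {x<..<z}. (f y - f z) / (y - z) \<le> (f z - f x) / (z - x)"
    unfolding eventually_at_filter
  proof (intro always_eventually allI impI)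
    fix y assume y: "y \<in> {x<..<z}"
    then have "(z - y) * f x + (y - x) * f z < (z - x) * f y"
      using strictly_concave_on_secant assms by auto
    then show "(f y - f z) / (y - z) \<le> (f z - f x) / (z - x)"
      using y by (simp add: divide_le_eq le_divide_eq) (simp add: field_simps)
  qed
  show "at z within {x<..<z} \<noteq> bot"
    using assms(4) by (simp add: at_within_eq_bot_iff)
qed

lemma strictly_concave_on_deriv_less:
  assumes "strictly_concave_on S f" "x \<in> S" "z \<in> S" "x < z"
    and "(f has_real_derivative l) (at x within S)"
    and "(f has_real_derivative m) (at z within S)"
  shows "m < l"
proof -
  \<comment> \<open>The limits give only weak tangent inequalities. Strictness comes from comparing
    the chords on the two sides of an intermediate point.\<close>
  define y where "y = (x + z) / 2"
  have y: "x < y" "y < z" using assms(4) by (auto simp: y_def)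
  have "convex S" using assms(1) by (simp add: strictly_concave_on_def)
  then have "y \<in> S"
    using assms(2,3) y by (meson convexD_alt connectedD_interval convex_connected less_imp_le)
  have "m \<le> (f z - f y) / (z - y)"
    using strictly_concave_on_right_tangent [OF assms(1) \<open>y \<in> S\<close> assms(3)] y assms(6) by simp
  also have "\<dots> < (f y - f x) / (y - x)"
    using strictly_concave_on_secant [OF assms(1-3) y] y
    by (simp add: divide_less_eq less_divide_eq) (simp add: field_simps)
  also have "\<dots> \<le> l"
    using strictly_concave_on_left_tangent [OF assms(1,2) \<open>y \<in> S\<close>] y assms(5) by simp
  finally show ?thesis .
qed

section \<open>Trade functions\<close>

lemma trade_function_has_derivative:
  assumes "trade_function f" "0 \<le> x"
  shows "(f has_real_derivative deriv_nonneg f x) (at x within {0..})"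
  using assms vector_derivative_works [of f "at x within {0..}"]
  by (simp add: trade_function_def differentiable_on_def deriv_nonneg_def
      has_real_derivative_iff_has_vector_derivative)

lemma deriv_nonneg_less:
  assumes "trade_function f" "0 \<le> x" "x < y"
  shows "deriv_nonneg f y < deriv_nonneg f x"
  using assms strictly_concave_on_deriv_less [of "{0..}" f x y] trade_function_has_derivative
  by (simp add: trade_function_def)

text \<open>The chord is at least as steep as the tangent at its right end, whose slope is
  positive.\<close>

lemma trade_function_less:
  assumes "trade_function f" "0 \<le> x" "x < y"
  shows "f x < f y"
proof -
  have "0 < deriv_nonneg f y" using assms by (simp add: trade_function_def)
  also have "\<dots> \<le> (f y - f x) / (y - x)"
    using assms trade_function_has_derivative [of f y]
    by (intro strictly_concave_on_right_tangent [of "{0..}"]) (auto simp: trade_function_def)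
  finally show ?thesis using assms by (simp add: zero_less_divide_iff)
qed

lemma trade_function_strict_mono_on: "trade_function f \<Longrightarrow> strict_mono_on {0..} f"
  by (auto intro: strict_mono_onI trade_function_less)

text \<open>Continuity of the inverse comes from compactness of \<open>{0..b}\<close> for some \<open>b > a\<close>.\<close>

lemma inverse_trade_has_derivative:
  assumes f: "trade_function f" and img: "f ` {0..} = {0..<r}" and y: "0 \<le> y" "y < r"
  defines "g \<equiv> inv_into {0..} f"
  shows "(g has_real_derivative 1 / deriv_nonneg f (g y)) (at y within {0..})"
proof -
  have mono: "strict_mono_on {0..} f" using f by (rule trade_function_strict_mono_on)
  have inj: "inj_on f {0..}" using mono by (rule strict_mono_on_imp_inj_on)
  define a where "a = g y"
  define b where "b = a + 1"
  have "y \<in> f ` {0..}" using y img by simp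
  then have a: "0 \<le> a" "f a = y"
    using inv_into_into [of y f "{0..}"] f_inv_into_f [of y f "{0..}"] by (auto simp: a_def g_def)
  have gf: "g (f x) = x" if "x \<in> {0..b}" for x
    using that inj by (simp add: g_def)
  have yb: "y < f b" using trade_function_less [OF f, of a b] a by (simp add: b_def)
  have sub: "f ` {0..b} = {0..f b}"
  proof
    show "f ` {0..b} \<subseteq> {0..f b}"
      using mono f a by (force simp: strict_mono_on_leD trade_function_def)
    have "f b \<in> f ` {0..}" using a by (simp add: b_def)
    then have "f b < r" using img by simp
    show "{0..f b} \<subseteq> f ` {0..b}"
    proof
      fix z assume z: "z \<in> {0..f b}"
      then have "z \<in> f ` {0..}" using img \<open>f b < r\<close> by simp
      then obtain x where x: "0 \<le> x" "z = f x" by auto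
      then have "x \<le> b" using z trade_function_less [OF f, of b x] a by (force simp: b_def)
      then show "z \<in> f ` {0..b}" using x by simp
    qed
  qed
  have der: "(f has_real_derivative deriv_nonneg f a) (at a within {0..b})"
    using trade_function_has_derivative [OF f a(1)] by (rule has_field_derivative_subset) auto
  have pos: "0 < deriv_nonneg f a" using f a by (simp add: trade_function_def)
  have "f differentiable_on {0..}" using f by (simp add: trade_function_def)
  then have "continuous_on {0..b} f"
    by (meson atLeastatMost_subset_iff continuous_on_subset differentiable_imp_continuous_on
        Icc_subset_Ici_iff order_refl)
  then have "continuous_on (f ` {0..b}) g"
    by (rule continuous_on_inv) (auto simp: gf)
  moreover have "f a \<in> f ` {0..b}" using a(1) by (intro imageI) (simp add: b_def)
  ultimately have cont: "continuous (at (f a) within f ` {0..b}) g"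
    unfolding continuous_on_eq_continuous_within by blast
  have "(g has_derivative (*) (1 / deriv_nonneg f a)) (at (f a) within f ` {0..b})"
    by (rule has_derivative_inverse_within [OF der [unfolded has_field_derivative_def] cont])
      (use a pos gf in \<open>auto simp: b_def fun_eq_iff intro: bounded_linear.linear bounded_linear_mult_right\<close>)
  then have "(g has_real_derivative 1 / deriv_nonneg f a) (at y within {0..f b})"
    using a sub by (simp add: has_field_derivative_def)
  \<comment> \<open>Since \<open>y < f b\<close>, the two sets agree near \<open>y\<close>, so the
    truncation at \<open>b\<close> leaves no trace in the result.\<close>
  moreover have "at y within {0..f b} = at y within {0..}"
    by (rule at_within_nhd [of _ "{..<f b}"]) (use yb in auto)
  ultimately show ?thesis by (simp add: a_def)
qed

section \<open>The price function\<close>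

context
  fixes p :: pool
  assumes valid: "valid_pool p"
begin

definition inv_YX :: "real \<Rightarrow> real" where
  "inv_YX = inv_into {0..} (trade_YX p)"

text \<open>\<open>deriv_XY_0\<close> puts the product condition on the slopes at 0 into the form in
  which the left and right derivatives of \<open>extended_trade\<close> at 0 are matched.\<close>

lemma tradeXY: "trade_function (trade_XY p)"
  and tradeYX: "trade_function (trade_YX p)"
  and deriv_XY_0: "1 / deriv_nonneg (trade_YX p) 0 = deriv_nonneg (trade_XY p) 0"
  and imgYX: "trade_YX p ` {0..} = {0..<reserve p}"
  using valid by (auto simp: valid_pool_def divide_eq_eq)

lemma inv_YX_0: "inv_YX 0 = 0"
  using tradeYX strict_mono_on_imp_inj_on [OF trade_function_strict_mono_on [OF tradeYX]]
    inv_into_f_f [of "trade_YX p" "{0..}" 0]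
  by (simp add: inv_YX_def trade_function_def)

lemma inv_YX_nonneg: "0 \<le> y \<Longrightarrow> y < reserve p \<Longrightarrow> 0 \<le> inv_YX y"
  using inv_into_into [of y "trade_YX p" "{0..}"] imgYX by (simp add: inv_YX_def)

lemma inv_YX_less:
  assumes "0 \<le> y" "y < z" "z < reserve p"
  shows "inv_YX y < inv_YX z"
proof -
  have "trade_YX p (inv_YX y) = y" "trade_YX p (inv_YX z) = z"
    using assms imgYX by (simp_all add: inv_YX_def f_inv_into_f)
  moreover have "0 \<le> inv_YX z" using assms by (simp add: inv_YX_nonneg)
  ultimately show ?thesis
    using assms strict_mono_on_leD [OF trade_function_strict_mono_on [OF tradeYX], of "inv_YX z" "inv_YX y"]
    by force
qed

lemma extended_trade_has_derivative_right:
  assumes "0 \<le> x"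
  shows "(extended_trade p has_real_derivative deriv_nonneg (trade_XY p) x) (at x within {0..})"
  using trade_function_has_derivative [OF tradeXY assms]
  by (rule has_field_derivative_transform_within [OF _ zero_less_one])
    (use assms in \<open>auto simp: extended_trade_def\<close>)

text \<open>Reflection at 0 carries the derivative of the inverse within \<open>{0..}\<close> to one
  within \<open>{..0}\<close>; the inner and the outer sign change cancel.\<close>

lemma extended_trade_has_derivative_left:
  assumes "- reserve p < x" "x \<le> 0"
  shows "(extended_trade p has_real_derivative 1 / deriv_nonneg (trade_YX p) (inv_YX (- x)))
    (at x within {..0})"
proof -
  have "(inv_YX has_real_derivative 1 / deriv_nonneg (trade_YX p) (inv_YX (- x)))
      (at (- x) within uminus ` {..0})"
    using inverse_trade_has_derivative [OF tradeYX imgYX, of "- x"] assms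
    by (simp add: inv_YX_def)
  moreover have "(uminus has_real_derivative -1) (at x within {..0})"
    by (auto intro!: derivative_eq_intros)
  ultimately have "((\<lambda>x. inv_YX (- x)) has_real_derivative
      (1 / deriv_nonneg (trade_YX p) (inv_YX (- x))) * -1) (at x within {..0})"
    using DERIV_image_chain [of inv_YX _ uminus x "{..0}" "-1"] by (simp add: o_def)
  then have "((\<lambda>x. - inv_YX (- x)) has_real_derivative
      1 / deriv_nonneg (trade_YX p) (inv_YX (- x))) (at x within {..0})"
    using DERIV_minus by fastforce
  then show ?thesis
  proof (rule has_field_derivative_transform_within [OF _ zero_less_one])
    \<comment> \<open>At 0 \<open>extended_trade\<close> takes its other branch; the formulas still
      agree there, because both vanish.\<close>
    have "trade_XY p 0 = 0" using tradeXY by (simp add: trade_function_def)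
    then show "- inv_YX (- y) = extended_trade p y" if "y \<in> {..0}" for y
      using that inv_YX_0 by (cases "y = 0") (auto simp: extended_trade_def inv_YX_def)
  qed (use assms in auto)
qed

text \<open>The two branches meet with equal slopes by \<open>deriv_XY_0\<close>, so the two-sided
  \<open>deriv\<close> in \<open>price\<close> is meaningful at 0.\<close>

lemma extended_trade_has_derivative_0:
  "(extended_trade p has_real_derivative deriv_nonneg (trade_XY p) 0) (at 0)"
proof -
  have "0 < reserve p" using valid by (simp add: valid_pool_def)
  then have "(extended_trade p has_real_derivative deriv_nonneg (trade_XY p) 0) (at 0 within {..0})"
    using extended_trade_has_derivative_left [of 0] deriv_XY_0 inv_YX_0 by simp
  then have "(extended_trade p has_real_derivative deriv_nonneg (trade_XY p) 0)
      (at 0 within {..0} \<union> {0..})"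
    using extended_trade_has_derivative_right [of 0]
    unfolding has_field_derivative_iff by (simp add: Lim_Un)
  moreover have "{..0::real} \<union> {0..} = UNIV" by auto
  ultimately show ?thesis by simp
qed

lemma price_nonneg:
  assumes "0 \<le> x"
  shows "price p x = 1 / deriv_nonneg (trade_XY p) x"
proof (cases "x = 0")
  case True
  then show ?thesis
    using extended_trade_has_derivative_0 by (simp add: price_def DERIV_imp_deriv)
next
  case False
  then have "at x within {0..} = at x"
    using assms by (intro at_within_interior) auto
  then show ?thesis
    using extended_trade_has_derivative_right [OF assms] by (simp add: price_def DERIV_imp_deriv)
qed

lemma price_nonpos:
  assumes "- reserve p < x" "x \<le> 0"
  shows "price p x = deriv_nonneg (trade_YX p) (inv_YX (- x))"
proof (cases "x = 0")
  case True
  then show ?thesis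
    using price_nonneg [of 0] deriv_XY_0 [symmetric] inv_YX_0 by simp
next
  case False
  then have "at x within {..0} = at x"
    using assms by (intro at_within_interior) auto
  then show ?thesis
    using extended_trade_has_derivative_left [OF assms] by (simp add: price_def DERIV_imp_deriv)
qed

text \<open>On the right the price is the reciprocal of a decreasing positive derivative. On the
  left a decreasing derivative is evaluated at \<open>inv_YX (- x)\<close>, which decreases in
  \<open>x\<close>. Points on opposite sides are compared through 0.\<close>

lemma price_less:
  assumes "- reserve p < x" "x < y"
  shows "price p x < price p y"
proof -
  have nonneg: "price p x < price p y" if "0 \<le> x" "x < y" for x y
    using that tradeXY deriv_nonneg_less [OF tradeXY that]
    by (simp add: price_nonneg trade_function_def frac_less2)
  have nonpos: "price p x < price p y" if "- reserve p < x" "x < y" "y \<le> 0" for x y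
    using that inv_YX_less [of "- y" "- x"] inv_YX_nonneg [of "- y"]
    by (simp add: price_nonpos deriv_nonneg_less [OF tradeYX])
  consider "0 \<le> x" | "y \<le> 0" | "x < 0" "0 < y" by linarith
  then show ?thesis
    using assms nonneg [of x y] nonpos [of x y] nonpos [of x 0] nonneg [of 0 y]
    by cases auto
qed

lemma price_le: "- reserve p < x \<Longrightarrow> x \<le> y \<Longrightarrow> price p x \<le> price p y"
  using price_less [of x y] by (cases "x = y") auto

lemma price_less_cancel:
  "- reserve p < y \<Longrightarrow> price p x < price p y \<Longrightarrow> x < y"
  using price_le [of y x] by force

end

section \<open>Rounds\<close>

lemma is_donorD:
  assumes "is_donor pools N x D"
  shows "D \<in> {1..N}" "i \<in> {1..N} \<Longrightarrow> price (pools i) (x i) \<le> price (pools D) (x D)"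
  using assms by (auto simp: is_donor_def is_arg_max_def not_less)

lemma is_receiver_mem: "is_receiver pools N x R \<Longrightarrow> R \<in> {1..N}"
  by (simp add: is_receiver_def is_arg_min_def)

lemma greedy_nonneg: "greedy pools N s n x \<Longrightarrow> 0 \<le> s \<Longrightarrow> 0 \<le> x i"
  by (induction rule: greedy.induct) auto

lemma halving_le: "halving pools x D R \<delta> \<delta>' \<Longrightarrow> 0 \<le> \<delta> \<Longrightarrow> \<delta>' \<le> \<delta>"
  by (induction rule: halving.induct) auto

text \<open>The invariant of the rounds. The first clause keeps every pool where its price is
  strictly increasing; the second bounds all current prices by the price at 0 of each negative
  pool.\<close>

definition admissible :: "(nat \<Rightarrow> pool) \<Rightarrow> nat \<Rightarrow> allocation \<Rightarrow> bool" where
  "admissible pools N x \<longleftrightarrow>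
     (\<forall>i\<in>{1..N}. - reserve (pools i) < x i) \<and>
     (\<forall>j\<in>{1..N}. x j < 0 \<longrightarrow> (\<forall>i\<in>{1..N}. price (pools i) (x i) \<le> price (pools j) 0))"

text \<open>Portions are nonnegative, so no pool is negative and the price bound holds
  vacuously.\<close>

lemma admissible_greedy_initialization:
  assumes "\<And>i. i \<in> {1..N} \<Longrightarrow> valid_pool (pools i)" "0 \<le> q"
    and "greedy_initialization pools N q M x"
  shows "admissible pools N x"
proof -
  have "0 \<le> x i" for i
    using assms(2,3) greedy_nonneg [of pools N "q / real M" M x i]
    by (simp add: greedy_initialization_def)
  moreover have "0 < reserve (pools i)" if "i \<in> {1..N}" for i
    using assms(1) [OF that] by (simp add: valid_pool_def)
  ultimately show ?thesis
    unfolding admissible_def by (metis less_le_trans neg_less_0_iff_less not_less)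
qed

lemma transfer_round_preserves:
  assumes valid: "\<And>i. i \<in> {1..N} \<Longrightarrow> valid_pool (pools i)" and "0 \<le> \<epsilon>"
    and adm: "admissible pools N x"
    and step: "transfer_round pools N \<epsilon> x D R \<delta> x'"
    and legit: "legitimate pools x D R \<delta>"
  shows "admissible pools N x'" "S_plus N x \<subseteq> S_plus N x'" "S_minus N x \<subseteq> S_minus N x'"
proof -
  have donor: "is_donor pools N x D" and "is_receiver pools N x R"
    and "D \<noteq> R" and halving: "halving pools x D R (initial_delta pools x D) \<delta>"
    and x': "x' = x(D := x D - \<delta>, R := x R + \<delta>)"
    using step \<open>0 \<le> \<epsilon>\<close> by (auto simp: transfer_round_def stopping_def)
  then have D: "D \<in> {1..N}" and R: "R \<in> {1..N}"
    by (auto dest: is_donorD(1) is_receiver_mem)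
  have \<delta>: "0 < \<delta>" "price (pools R) (x R + \<delta>) \<le> price (pools D) (x D - \<delta>)"
    using legit by (auto simp: legitimate_def)
  have x'_D: "x' D = x D - \<delta>" and x'_R: "x' R = x R + \<delta>"
    and x'_other: "\<And>i. i \<noteq> D \<Longrightarrow> i \<noteq> R \<Longrightarrow> x' i = x i"
    using \<open>D \<noteq> R\<close> by (auto simp: x')
  have dom: "- reserve (pools i) < x i" if "i \<in> {1..N}" for i
    using adm that by (simp add: admissible_def)
  have reserve: "0 < reserve (pools i)" if "i \<in> {1..N}" for i
    using valid [OF that] by (simp add: valid_pool_def)
  \<comment> \<open>The initial \<open>\<delta>\<close> is half the distance from \<open>x D\<close>
    to 0 or to the lower end of the domain, and halving only shrinks it. Hence neither barrier is
    reached.\<close>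
  have "\<delta> \<le> initial_delta pools x D"
    using dom [OF D] by (intro halving_le [OF halving]) (simp add: initial_delta_def)
  then have x'_D_pos: "0 < x D \<Longrightarrow> 0 < x' D" and "- reserve (pools D) < x' D"
    using dom [OF D] reserve [OF D] unfolding initial_delta_def x'_D
    by (cases "0 < x D"; force)+
  then have dom': "- reserve (pools i) < x' i" if "i \<in> {1..N}" for i
    using dom [OF that] \<open>0 < \<delta>\<close> that x'_R x'_other [of i] by (cases "i = D"; cases "i = R") auto
  have D_less: "price (pools D) (x' D) < price (pools D) (x D)"
    using dom' [OF D] \<open>0 < \<delta>\<close> by (intro price_less valid [OF D]) (auto simp: x'_D)
  \<comment> \<open>Legitimacy compares the two new prices, and the donor's new price lies strictly
    below its old one.\<close>
  have R_less: "price (pools R) (x' R) < price (pools D) (x D)"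
    using \<delta>(2) D_less by (simp add: x'_D x'_R)
  have max_le: "price (pools i) (x' i) \<le> price (pools D) (x D)" if "i \<in> {1..N}" for i
    using is_donorD(2) [OF donor that] D_less R_less x'_other [of i]
    by (cases "i = D"; cases "i = R") auto
  have bound: "price (pools D) (x D) \<le> price (pools j) 0" if "j \<in> {1..N}" "x j < 0" for j
    using adm that D by (simp add: admissible_def)
  have R_neg: "x' R < 0" if "x R < 0"
  proof (rule price_less_cancel [OF valid [OF R]])
    show "price (pools R) (x' R) < price (pools R) 0" using R_less bound [OF R that] by simp
  qed (use reserve [OF R] in simp)
  show "S_plus N x \<subseteq> S_plus N x'"
    using x'_D_pos x'_R x'_other \<open>0 < \<delta>\<close> by (force simp: S_plus_def)
  show "S_minus N x \<subseteq> S_minus N x'"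
    using R_neg x'_D x'_other \<open>0 < \<delta>\<close> by (force simp: S_minus_def)
  have "price (pools D) (x D) \<le> price (pools j) 0" if j: "j \<in> {1..N}" "x' j < 0" for j
  proof (cases "x j < 0")
    case True
    then show ?thesis using bound j by simp
  next
    case False
    then have "j = D" using j x'_R x'_other [of j] \<open>0 < \<delta>\<close> by (cases "j = D"; cases "j = R") auto
    \<comment> \<open>A positive donor stays positive, so a pool that has just turned negative gave
      from \<open>x D = 0\<close>, and its old price, the maximum, is its price at 0.\<close>
    moreover have "x D \<le> 0" using x'_D_pos j \<open>j = D\<close> by force
    ultimately show ?thesis using price_le [OF valid [OF D] dom [OF D]] by simp
  qed
  then show "admissible pools N x'"
    using dom' max_le unfolding admissible_def by (meson order_trans)
qed

theorem theorem9:
  fixes pools :: "nat \<Rightarrow> pool" and N :: nat and q \<epsilon> :: real and M :: nat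
    and K :: enat and x :: "nat \<Rightarrow> allocation" and D R :: "nat \<Rightarrow> nat" and \<delta> :: "nat \<Rightarrow> real"
  assumes "\<And>i. i \<in> {1..N} \<Longrightarrow> valid_pool (pools i)"
    and "q \<ge> 0" and "\<epsilon> \<ge> 0" and "M \<ge> 1"
    and "transfer_run pools N q \<epsilon> M K x D R \<delta>"
    and "\<And>k. enat k < K \<Longrightarrow> legitimate pools (x k) (D k) (R k) (\<delta> k)"
  shows "(\<forall>j l. enat l \<le> K \<and> j \<in> S_plus N (x l) \<longrightarrow>
            (\<forall>m. l < m \<and> enat m \<le> K \<longrightarrow> j \<in> S_plus N (x m))) \<and>
         (\<forall>j l. enat l \<le> K \<and> j \<in> S_minus N (x l) \<longrightarrow>
            (\<forall>m. l < m \<and> enat m \<le> K \<longrightarrow> j \<in> S_minus N (x m)))"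
proof -
  have init: "greedy_initialization pools N q M (x 0)"
    and step: "\<And>k. enat k < K \<Longrightarrow> transfer_round pools N \<epsilon> (x k) (D k) (R k) (\<delta> k) (x (Suc k))"
    using assms(5) by (auto simp: transfer_run_def)
  note preserves = transfer_round_preserves [OF assms(1,3) _ step assms(6)]
  \<comment> \<open>Only indices up to \<open>K\<close> qualify, as the sequences are arbitrary
    beyond the end of the run.\<close>
  have adm: "admissible pools N (x k)" if "enat k \<le> K" for k
    using that
  proof (induction k)
    case 0
    show ?case using admissible_greedy_initialization [OF assms(1,2) init] .
  next
    case (Suc k)
    then have "enat k < K" by (simp add: Suc_ile_eq)
    then show ?case using Suc.IH preserves(1) by simp
  qed
  have "S_plus N (x l) \<subseteq> S_plus N (x m) \<and> S_minus N (x l) \<subseteq> S_minus N (x m)"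
    if "l \<le> m" "enat m \<le> K" for l m
    using that
  proof (induction m rule: dec_induct)
    case base
    show ?case by simp
  next
    case (step m)
    then have "enat m < K" by (simp add: Suc_ile_eq)
    moreover from this have "admissible pools N (x m)" by (simp add: adm)
    ultimately show ?case using step.IH preserves(2,3) by (meson order_trans less_imp_le)
  qed
  then show ?thesis by (meson less_imp_le subsetD)
qed

end
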